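(* Let $S\neq\mathbb{N}$ be a numerical semigroup and let $F$ be a positive integer. If $2\operatorname{F}(S)\le F$, then $\{T\in\mathcal{D}_2(S)\mid \operatorname{F}(T)\le F\}$ is equal to the union of \[\{S(m,\mathbb{N}\setminus S)\mid m \text{ is an odd element of } \{\operatorname{F}(S)+1,\dots,F+2\}\}\] and \[\{S(m,H)\mid m \text{ is an odd element of } S,\ H\neq\mathbb{N}\setminus S \text{ is an upper } m\text{-set of } S,\ \text{and } 2\max(\mathbb{N}\setminus(S\cup H))+m\le F\}.\]
   Context: $\mathbb{N}$ denotes the set of non-negative integers. A numerical semigroup is a subset $S\subseteq\mathbb{N}$ containing $0$, closed under addition, with $\mathbb{N}\setminus S$ finite. Its Frobenius number is $\operatorname{F}(S)=\max(\mathbb{Z}\setminus S)$. For a numerical semigroup $T$, $\frac{T}{2}:=\{x\in\mathbb{N}\mid 2x\in T\}$, and $\mathcal{D}_2(S)$ is the set of numerical semigroups $T$ such that $S=\frac{T}{2}$. Let $S\subsetneq\mathbb{N}$ be a numerical semigroup and $m$ an odd element of $S$. An upper $m$-set of $S$ is a subset $H$ of $\mathbb{N}\setminus S$ such that: (C1) $\{h+m\mid h\in H\}\subseteq S$; (C2) $\{h_1+h_2+m\mid h_1,h_2\in H\}\subseteq S$; (C3) if $h\in H$, then $\{x\in\mathbb{N}\setminus S\mid x-h\in S\}\subseteq H$. If $H$ is an upper $m$-set of $S$, then $S(m,H):=\{2s\mid s\in S\}\cup\{2s+m\mid s\in S\}\cup\{2h+m\mid h\in H\}$, which is a numerical semigroup.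 For odd $m>\operatorname{F}(S)$, the set $\mathbb{N}\setminus S$ is an upper $m$-set of $S$. *)

theory Defs
  imports Main
begin

definition numerical_semigroup :: "nat set \<Rightarrow> bool" where
  "numerical_semigroup S \<longleftrightarrow>
     0 \<in> S \<and> (\<forall>x\<in>S. \<forall>y\<in>S. x + y \<in> S) \<and> finite (UNIV - S)"

text \<open>The maximum is taken over the integers outside \<open>S\<close>, so the value is \<open>-1\<close> for \<open>S = UNIV\<close>.\<close>

definition frobenius :: "nat set \<Rightarrow> int" where
  "frobenius S = (GREATEST z. z \<notin> int ` S)"

definition half :: "nat set \<Rightarrow> nat set" where
  "half T = {x. 2 * x \<in> T}"

definition doubles :: "nat set \<Rightarrow> nat set set" where
  "doubles S = {T. numerical_semigroup T \<and> S = half T}"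

text \<open>The conditions on \<open>S\<close> and \<open>m\<close> (\<open>S\<close> a proper numerical semigroup, \<open>m\<close> an odd
  element of \<open>S\<close>) are not part of the predicate and are imposed where it is used. In the last
  clause the difference is that of integers, hence the guard \<open>h \<le> x\<close>.\<close>

definition upper_set :: "nat set \<Rightarrow> nat \<Rightarrow> nat set \<Rightarrow> bool" where
  "upper_set S m H \<longleftrightarrow>
     H \<subseteq> UNIV - S \<and>
     {h + m | h. h \<in> H} \<subseteq> S \<and>
     {h1 + h2 + m | h1 h2. h1 \<in> H \<and> h2 \<in> H} \<subseteq> S \<and>
     (\<forall>h\<in>H. {x \<in> UNIV - S. h \<le> x \<and> x - h \<in> S} \<subseteq> H)"

definition double_of :: "nat set \<Rightarrow> nat \<Rightarrow> nat set \<Rightarrow> nat set" where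
  "double_of S m H =
     {2 * s | s. s \<in> S} \<union> {2 * s + m | s. s \<in> S} \<union> {2 * h + m | h. h \<in> H}"

end

theory Submission imports Defs begin

text \<open>
  Every \<open>T\<close> in \<open>doubles S\<close> is determined by its odd elements, since its even
  elements are the numbers \<open>2 * s\<close> with \<open>s \<in> S\<close>. Let \<open>m\<close> be the least odd element of \<open>T\<close>. Then
  \<open>m + m \<in> T\<close> gives \<open>m \<in> S\<close>, and every odd element is \<open>2 * x + m\<close> for some natural \<open>x\<close>. All
  \<open>x \<in> S\<close> occur here; let \<open>H\<close> be the set of gaps \<open>x\<close> of \<open>S\<close> that occur. Closure of \<open>T\<close> under
  addition makes \<open>H\<close> an upper set, and \<open>T = double_of S m H\<close>. Conversely, the conditions of an upper
  set are what closure of \<open>double_of S m H\<close> under addition requires. So the members of \<open>doubles S\<close>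
  are the sets \<open>double_of S m H\<close> (\<open>doubles_obtain_upper_set\<close>, \<open>double_of_in_doubles\<close>).

  It remains to read off the Frobenius number. The even gaps of \<open>double_of S m H\<close> are the doubled gaps
  of \<open>S\<close>, and \<open>2 * frobenius S \<le> F\<close> bounds them. The odd gaps are the odd numbers below \<open>m\<close>
  and the numbers \<open>2 * k + m\<close> with \<open>k \<notin> S \<union> H\<close>. If \<open>H\<close> misses some gap of \<open>S\<close>, the gaps of the
  second kind exist and exceed those of the first kind, so the bound is on the largest such \<open>k\<close>.
  If \<open>H\<close> is the set of all gaps of \<open>S\<close>, only the odd numbers up to \<open>m - 2\<close> remain and the bound
  is \<open>m \<le> F + 2\<close>; moreover the set of all gaps is an upper set exactly for those
  \<open>m \<in> S\<close> that exceed the Frobenius number (\<open>upper_set_gaps_iff\<close>).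
\<close>

lemma frobenius_eq_Max_gaps:
  assumes "finite (UNIV - S)" "S \<noteq> UNIV"
  shows "frobenius S = int (Max (UNIV - S))"
  unfolding frobenius_def
proof (rule Greatest_equality)
  have "Max (UNIV - S) \<in> UNIV - S" by (rule Max_in) (use assms in blast)+
  then show "int (Max (UNIV - S)) \<notin> int ` S" by (simp add: image_iff)
next
  fix z assume z: "z \<notin> int ` S"
  show "z \<le> int (Max (UNIV - S))"
  proof (cases "z < 0")
    case False
    then obtain n where n: "z = int n" by (metis not_less zero_le_imp_eq_int)
    with z have "n \<in> UNIV - S" by auto
    then show ?thesis using assms(1) n by simp
  qed simp
qed

lemma frobenius_le_iff_gaps_le:
  assumes "finite (UNIV - S)" "S \<noteq> UNIV"
  shows "frobenius S \<le> F \<longleftrightarrow> (\<forall>n. n \<notin> S \<longrightarrow> int n \<le> F)"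
proof -
  have "Max (UNIV - S) \<in> UNIV - S" by (rule Max_in) (use assms in blast)+
  moreover have "int n \<le> int (Max (UNIV - S))" if "n \<notin> S" for n using assms that by simp
  ultimately show ?thesis
    unfolding frobenius_eq_Max_gaps[OF assms] by (meson DiffD2 order_trans)
qed

lemma even_mem_double_of_iff:
  assumes "odd m"
  shows "2 * x \<in> double_of S m H \<longleftrightarrow> x \<in> S"
proof -
  have "2 * x \<noteq> 2 * y + m" for y using assms by presburger
  then show ?thesis by (auto simp: double_of_def)
qed

lemma odd_mem_double_of_iff:
  assumes "odd m"
  shows "2 * x + m \<in> double_of S m H \<longleftrightarrow> x \<in> S \<union> H"
proof -
  have "2 * x + m \<noteq> 2 * y" for y using assms by presburger
  then show ?thesis by (auto simp: double_of_def)
qed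

lemma double_of_cases:
  assumes "t \<in> double_of S m H"
  obtains (even) s where "t = 2 * s" "s \<in> S" | (odd) x where "t = 2 * x + m" "x \<in> S \<union> H"
  using assms unfolding double_of_def by blast

lemma nat_parity_cases:
  fixes m n :: nat
  assumes "odd m"
  obtains (even) x where "n = 2 * x"
    | (odd_below) "odd n" "n < m"
    | (odd_above) x where "n = 2 * x + m"
proof -
  consider "even n" | "odd n" "n < m" | "odd n" "m \<le> n" by linarith
  then show thesis
  proof cases
    case 3
    with assms have "even (n - m)" by simp
    then obtain x where "n - m = 2 * x" by blast
    with 3 show thesis by (intro odd_above[of x]) simp
  qed (use even odd_below in blast)+
qed

text \<open>Each condition on \<open>m\<close> and \<open>H\<close> serves one kind of sum. An even plus an odd element stays in the
  set because \<open>S \<union> H\<close> is stable under adding elements of \<open>S\<close>. For the sum of the odd elements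
  belonging to \<open>x\<close> and \<open>y\<close> one needs \<open>x + y + m \<in> S\<close>: this is \<open>m \<in> S\<close>, the first or the second
  condition according to whether none, one or both of \<open>x\<close>, \<open>y\<close> lie in \<open>H\<close>.\<close>

lemma double_of_in_doubles:
  assumes S: "numerical_semigroup S" and m: "odd m" "m \<in> S" and H: "upper_set S m H"
  shows "double_of S m H \<in> doubles S"
proof -
  let ?T = "double_of S m H"
  have add: "x + y \<in> S" if "x \<in> S" "y \<in> S" for x y
    using S that by (auto simp: numerical_semigroup_def)
  have HC1: "h + m \<in> S" if "h \<in> H" for h using H that by (auto simp: upper_set_def)
  have HC2: "h + k + m \<in> S" if "h \<in> H" "k \<in> H" for h k
    using H that unfolding upper_set_def by blast
  have HC3: "s + h \<in> S \<union> H" if "h \<in> H" "s \<in> S" for h s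
  proof -
    have "{x \<in> UNIV - S. h \<le> x \<and> x - h \<in> S} \<subseteq> H"
      using H that(1) unfolding upper_set_def by simp
    from subsetD[OF this, of "s + h"] show ?thesis using that(2) by auto
  qed
  have shift: "s + x \<in> S \<union> H" if "s \<in> S" "x \<in> S \<union> H" for s x
    using that add HC3 by blast
  have odds: "x + y + m \<in> S" if "x \<in> S \<union> H" "y \<in> S \<union> H" for x y
  proof -
    have "x + (y + m) \<in> S" if "x \<in> S" "y \<in> S \<union> H" for x y
      using that add m HC1 by blast
    then show ?thesis using that HC2 by (metis Un_iff add.assoc add.commute)
  qed
  have "t + u \<in> ?T" if t: "t \<in> ?T" and u: "u \<in> ?T" for t u
    using t
  proof (cases rule: double_of_cases)
    case t: (even s)
    from u show ?thesis
    proof (cases rule: double_of_cases)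
      case u: (even r)
      have "2 * (s + r) \<in> ?T" unfolding even_mem_double_of_iff[OF m(1)] using t u add by blast
      then show ?thesis using t u by (simp add: algebra_simps)
    next
      case u: (odd x)
      have "2 * (s + x) + m \<in> ?T" unfolding odd_mem_double_of_iff[OF m(1)] using t u shift by blast
      then show ?thesis using t u by (simp add: algebra_simps)
    qed
  next
    case t: (odd x)
    from u show ?thesis
    proof (cases rule: double_of_cases)
      case u: (even s)
      have "2 * (s + x) + m \<in> ?T" unfolding odd_mem_double_of_iff[OF m(1)] using t u shift by blast
      then show ?thesis using t u by (simp add: algebra_simps)
    next
      case u: (odd y)
      have "2 * (x + y + m) \<in> ?T" unfolding even_mem_double_of_iff[OF m(1)] using t u odds by blast
      then show ?thesis using t u by (simp add: algebra_simps)
    qed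
  qed
  moreover have "0 \<in> ?T"
    using even_mem_double_of_iff[OF m(1), of 0] S by (simp add: numerical_semigroup_def)
  moreover have "finite (UNIV - ?T)"
  proof (rule finite_subset)
    show "UNIV - ?T \<subseteq> (\<lambda>x. 2 * x) ` (UNIV - S) \<union> {..<m} \<union> (\<lambda>x. 2 * x + m) ` (UNIV - S)"
    proof
      fix n assume n: "n \<in> UNIV - ?T"
      show "n \<in> (\<lambda>x. 2 * x) ` (UNIV - S) \<union> {..<m} \<union> (\<lambda>x. 2 * x + m) ` (UNIV - S)"
        by (cases rule: nat_parity_cases[OF m(1), of n])
          (use n m even_mem_double_of_iff odd_mem_double_of_iff in auto)
    qed
  qed (use S in \<open>simp add: numerical_semigroup_def\<close>)
  ultimately have "numerical_semigroup ?T" by (simp add: numerical_semigroup_def)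
  moreover have "half ?T = S" using m even_mem_double_of_iff by (auto simp: half_def)
  ultimately show ?thesis by (simp add: doubles_def)
qed

text \<open>The witness \<open>m\<close> is the least odd element of \<open>T\<close>, which exists because \<open>T\<close> is cofinite.
  Minimality leaves no odd element of \<open>T\<close> outside the progression \<open>m, m + 2, \<dots>\<close>.\<close>

lemma doubles_obtain_upper_set:
  assumes T: "T \<in> doubles S"
  obtains m H where "odd m" "m \<in> S" "upper_set S m H" "T = double_of S m H"
proof -
  have add: "x + y \<in> T" if "x \<in> T" "y \<in> T" for x y
    using T that by (auto simp: doubles_def numerical_semigroup_def)
  have fin: "finite (UNIV - T)" and S: "\<And>x. x \<in> S \<longleftrightarrow> 2 * x \<in> T"
    using T by (auto simp: doubles_def numerical_semigroup_def half_def)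
  have odd_ex: "\<exists>t. t \<in> T \<and> odd t"
  proof (rule ccontr)
    assume "\<nexists>t. t \<in> T \<and> odd t"
    then have "range (\<lambda>n. 2 * n + 1) \<subseteq> UNIV - T" by auto
    then have "finite (range (\<lambda>n::nat. 2 * n + 1))" using fin finite_subset by blast
    then show False by (simp add: finite_image_iff inj_on_def)
  qed
  define m where "m = (LEAST t. t \<in> T \<and> odd t)"
  have m: "m \<in> T" "odd m"
    using LeastI_ex[OF odd_ex] by (simp_all add: m_def)
  have least: "m \<le> t" if "t \<in> T" "odd t" for t
    using that by (simp add: m_def Least_le)
  define H where "H = {x. x \<notin> S \<and> 2 * x + m \<in> T}"
  have "m \<in> S" using add[OF m(1) m(1)] S by (simp add: mult_2)
  have SH: "x \<in> S \<union> H \<longleftrightarrow> 2 * x + m \<in> T" for x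
    using S add m(1) by (auto simp: H_def)
  have C1: "h + m \<in> S" if "h \<in> H" for h
  proof -
    have "2 * h + m \<in> T" using that by (simp add: H_def)
    from add[OF this m(1)] show ?thesis using S by (simp add: algebra_simps)
  qed
  have C2: "h + k + m \<in> S" if "h \<in> H" "k \<in> H" for h k
  proof -
    have "2 * h + m \<in> T" "2 * k + m \<in> T" using that by (simp_all add: H_def)
    from add[OF this] show ?thesis using S by (simp add: algebra_simps)
  qed
  have C3: "x \<in> H" if "h \<in> H" "x \<notin> S" "h \<le> x" "x - h \<in> S" for h x
  proof -
    have "2 * h + m \<in> T" "2 * (x - h) \<in> T" using that S by (simp_all add: H_def)
    from add[OF this] show ?thesis using that by (simp add: H_def diff_mult_distrib2 add.commute)
  qed
  have "upper_set S m H"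
    unfolding upper_set_def using C1 C2 C3 by (auto simp: H_def)
  moreover have "T = double_of S m H"
  proof (rule set_eqI)
    fix n
    show "n \<in> T \<longleftrightarrow> n \<in> double_of S m H"
    proof (cases rule: nat_parity_cases[OF m(2), of n, case_names even odd_below odd_above])
      case odd_below
      then have "n \<notin> T" using least by force
      moreover have "n \<notin> double_of S m H"
        using odd_below by (auto elim!: double_of_cases)
      ultimately show ?thesis by simp
    qed (use S SH m even_mem_double_of_iff odd_mem_double_of_iff in auto)
  qed
  ultimately show thesis using that m \<open>m \<in> S\<close> by blast
qed

text \<open>If an element \<open>m\<close> of \<open>S\<close> lies below the largest gap \<open>f\<close>, then \<open>f - m\<close> is again a gap, and
  adding \<open>m\<close> to it gives \<open>f \<notin> S\<close>; this violates the first condition of an upper set.\<close>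

lemma upper_set_gaps_iff:
  assumes S: "numerical_semigroup S" "S \<noteq> UNIV" and m: "m \<in> S"
  shows "upper_set S m (UNIV - S) \<longleftrightarrow> frobenius S < int m"
proof -
  have fin: "finite (UNIV - S)" using S by (simp add: numerical_semigroup_def)
  define f where "f = Max (UNIV - S)"
  have f: "f \<notin> S" "frobenius S = int f"
    using Max_in[OF fin] S(2) frobenius_eq_Max_gaps[OF fin S(2)] by (auto simp: f_def)
  have above: "n \<in> S" if "f < n" for n
    using that Max_ge[OF fin, of n] by (force simp: f_def)
  show ?thesis
  proof
    assume U: "upper_set S m (UNIV - S)"
    show "frobenius S < int m"
    proof (rule ccontr)
      assume "\<not> frobenius S < int m"
      then have le: "m \<le> f" using f by simp
      then have "f - m \<notin> S"
        using S(1) m f(1) unfolding numerical_semigroup_def by (metis le_add_diff_inverse2)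
      then have "(f - m) + m \<in> S" using U unfolding upper_set_def by blast
      then show False using le f by simp
    qed
  next
    assume "frobenius S < int m"
    then have "f < m" using f by simp
    then show "upper_set S m (UNIV - S)"
      unfolding upper_set_def by (auto intro: above)
  qed
qed

text \<open>The three parts of the gap set of \<open>double_of S m H\<close> are bounded separately: the doubled gaps of
  \<open>S\<close> by hypothesis, the odd numbers below \<open>m\<close> through their maximum \<open>m - 2\<close>, and the numbers
  \<open>2 * k + m\<close> one by one.\<close>

lemma frobenius_double_of_le_iff:
  assumes S: "numerical_semigroup S" "S \<noteq> UNIV" and m: "odd m" "m \<in> S"
    and H: "upper_set S m H" and F: "2 * frobenius S \<le> F"
  shows "frobenius (double_of S m H) \<le> F \<longleftrightarrow>
    int m \<le> F + 2 \<and> (\<forall>k. k \<notin> S \<union> H \<longrightarrow> 2 * int k + int m \<le> F)"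
proof -
  let ?T = "double_of S m H"
  have finS: "finite (UNIV - S)" using S by (simp add: numerical_semigroup_def)
  have T: "numerical_semigroup ?T" "half ?T = S"
    using double_of_in_doubles[OF S(1) m H] by (simp_all add: doubles_def)
  have finT: "finite (UNIV - ?T)" using T by (simp add: numerical_semigroup_def)
  have "?T \<noteq> UNIV" using T(2) S(2) by (auto simp: half_def)
  note le_iff = frobenius_le_iff_gaps_le[OF finT this]
  have below: "n \<notin> ?T" if "odd n" "n < m" for n
    using that by (auto elim!: double_of_cases)
  have "frobenius S \<ge> 0" using frobenius_eq_Max_gaps[OF finS S(2)] by simp
  then have "F \<ge> 0" using F by simp
  have evens: "int (2 * x) \<le> F" if "x \<notin> S" for x
    using frobenius_le_iff_gaps_le[OF finS S(2), of "frobenius S"] that F by force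
  show ?thesis
  proof
    assume "frobenius ?T \<le> F"
    then have gaps: "int n \<le> F" if "n \<notin> ?T" for n using that le_iff by simp
    have "int m \<le> F + 2"
    proof (cases "m \<ge> 2")
      case True
      have "m - 2 \<notin> ?T" using True m(1) by (intro below) auto
      from gaps[OF this] show ?thesis using True by simp
    qed (use \<open>F \<ge> 0\<close> in simp)
    moreover have "2 * int k + int m \<le> F" if "k \<notin> S \<union> H" for k
      using gaps[of "2 * k + m"] that odd_mem_double_of_iff[OF m(1)] by simp
    ultimately show "int m \<le> F + 2 \<and> (\<forall>k. k \<notin> S \<union> H \<longrightarrow> 2 * int k + int m \<le> F)" by blast
  next
    assume R: "int m \<le> F + 2 \<and> (\<forall>k. k \<notin> S \<union> H \<longrightarrow> 2 * int k + int m \<le> F)"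
    have "int n \<le> F" if n: "n \<notin> ?T" for n
    proof (cases rule: nat_parity_cases[OF m(1), of n, case_names even odd_below odd_above])
      case (even x)
      then show ?thesis using n evens even_mem_double_of_iff[OF m(1)] by blast
    next
      case odd_below
      \<comment> \<open>Two odd numbers differ by at least 2.\<close>
      then have "n + 2 \<le> m" using m(1) by presburger
      then show ?thesis using R by simp
    next
      case (odd_above x)
      then show ?thesis using n R odd_mem_double_of_iff[OF m(1)] by simp
    qed
    then show "frobenius ?T \<le> F" using le_iff by simp
  qed
qed

theorem theorem34:
  fixes S :: "nat set" and F :: int
  assumes "numerical_semigroup S" and "S \<noteq> UNIV"
    and "F > 0" and "2 * frobenius S \<le> F"
  shows "{T \<in> doubles S. frobenius T \<le> F} =
    {double_of S m (UNIV - S) | m. odd m \<and> int m \<in> {frobenius S + 1..F + 2}} \<union>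
    {double_of S m H | m H. odd m \<and> m \<in> S \<and> upper_set S m H \<and> H \<noteq> UNIV - S \<and>
       2 * int (Max (UNIV - (S \<union> H))) + int m \<le> F}"
proof -
  note S = assms(1,2)
  have fin: "finite (UNIV - S)" using S by (simp add: numerical_semigroup_def)
  have gaps_case: "odd m \<and> m \<in> S \<and> upper_set S m (UNIV - S) \<and>
      frobenius (double_of S m (UNIV - S)) \<le> F \<longleftrightarrow>
      odd m \<and> int m \<in> {frobenius S + 1..F + 2}" for m
  proof -
    have "m \<in> S" if "frobenius S < int m"
      using that frobenius_le_iff_gaps_le[OF fin S(2), of "frobenius S"] by force
    then show ?thesis
      using upper_set_gaps_iff[OF S] frobenius_double_of_le_iff[OF S _ _ _ assms(4)] by auto
  qed
  have proper_case: "frobenius (double_of S m H) \<le> F \<longleftrightarrow>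
      2 * int (Max (UNIV - (S \<union> H))) + int m \<le> F"
    if m: "odd m" "m \<in> S" and H: "upper_set S m H" "H \<noteq> UNIV - S" for m H
  proof -
    define k where "k = Max (UNIV - (S \<union> H))"
    have finSH: "finite (UNIV - (S \<union> H))" using fin by (rule rev_finite_subset) blast
    have "H \<subseteq> UNIV - S" using H(1) by (simp add: upper_set_def)
    then have "UNIV - (S \<union> H) \<noteq> {}" using H(2) by blast
    from Max_in[OF finSH this] have k: "k \<notin> S \<union> H" by (simp add: k_def)
    have ge: "i \<le> k" if "i \<notin> S \<union> H" for i
      using that Max_ge[OF finSH, of i] by (simp add: k_def)
    show ?thesis
      unfolding frobenius_double_of_le_iff[OF S m H(1) assms(4)] k_def[symmetric]
      using k ge by fastforce
  qed
  have "{T \<in> doubles S. frobenius T \<le> F} =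
    {double_of S m H | m H. odd m \<and> m \<in> S \<and> upper_set S m H \<and> frobenius (double_of S m H) \<le> F}"
    using double_of_in_doubles[OF S(1)] by (blast elim: doubles_obtain_upper_set)
  also have "\<dots> = {double_of S m (UNIV - S) | m. odd m \<and> m \<in> S \<and> upper_set S m (UNIV - S) \<and>
        frobenius (double_of S m (UNIV - S)) \<le> F} \<union>
      {double_of S m H | m H. odd m \<and> m \<in> S \<and> upper_set S m H \<and> H \<noteq> UNIV - S \<and>
        frobenius (double_of S m H) \<le> F}"
    by blast
  also have "\<dots> = {double_of S m (UNIV - S) | m. odd m \<and> int m \<in> {frobenius S + 1..F + 2}} \<union>
      {double_of S m H | m H. odd m \<and> m \<in> S \<and> upper_set S m H \<and> H \<noteq> UNIV - S \<and>
        2 * int (Max (UNIV - (S \<union> H))) + int m \<le> F}"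
    unfolding gaps_case using proper_case by blast
  finally show ?thesis .
qed

end
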